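(* In the payment network creation game with $n\ge 6$ players, for all weights $b\ge 0$ and $c>0$, the path graph is never a Nash equilibrium; i.e., no strategy combination $s$ with $G[s]$ a path on all $n$ players is a Nash equilibrium.
   Context: Payment network creation game. There are $n$ players $[n]=\{0,1,\dots,n-1\}$. A strategy of player $u$ is a set $s_u\subseteq [n]\setminus\{u\}$ (the players to whom $u$ opens a channel). A strategy combination is $s=(s_0,\dots,s_{n-1})$, and $G[s]$ is the undirected simple graph on $[n]$ in which $u,v$ are adjacent iff $v\in s_u$ or $u\in s_v$. With weights $b\ge 0$ and $c>0$, the cost of $u$ is $$\mathrm{cost}_u(s)=|s_u|+b\cdot \mathrm{betweenness}_u(s)+c\cdot \mathrm{closeness}_u(s),$$ $$\mathrm{betweenness}_u(s)=(n-1)(n-2)-\sum_{\substack{(i,j)\in[n]^2:\ i\ne j,\ i\neq u,\ j\ne u,\\ m(i,j)>0}}\frac{m_u(i,j)}{m(i,j)},\qquad \mathrm{closeness}_u(s)=\sum_{v\in[n]\setminus\{u\}}\bigl(d_{G[s]}(u,v)-1\bigr).$$ The sum in the betweenness runs over ordered pairs; $m(i,j)$ is the number of shortest paths between $i$ and $j$ in $G[s]$ and $m_u(i,j)$ the number of those passing through $u$; $d_{G[s]}$ is graph distance, equal to $\infty$ between different components. A strategy combination $s$ is a Nash equilibrium if no player can strictly decrease her cost by unilaterally changing her strategy. *)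

theory Defs
  imports Graph_Theory.Graph_Theory
begin

text \<open>
  A strategy combination of the players \<open>{..<n}\<close> is a function \<open>nat \<Rightarrow> nat set\<close> of which only the
  values below \<open>n\<close> matter. Undirected simple graphs are represented, as in \<open>pair_graph\<close>, by
  symmetric loop-free digraphs: an undirected edge is a pair of opposite arcs.
\<close>

definition strategies :: "nat \<Rightarrow> nat \<Rightarrow> nat set set" where
  "strategies n u = Pow ({..<n} - {u})"

definition strategy_combination :: "nat \<Rightarrow> (nat \<Rightarrow> nat set) \<Rightarrow> bool" where
  "strategy_combination n s \<longleftrightarrow> (\<forall>u<n. s u \<in> strategies n u)"

definition channel_graph :: "nat \<Rightarrow> (nat \<Rightarrow> nat set) \<Rightarrow> nat pair_pre_digraph" where
  "channel_graph n s =
     \<lparr> pverts = {..<n},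
       parcs = {(u, v). u < n \<and> v < n \<and> u \<noteq> v \<and> (v \<in> s u \<or> u \<in> s v)} \<rparr>"

lemma pair_graph_channel_graph: "pair_graph (channel_graph n s)"
proof -
  have "finite {(u, v). u < n \<and> v < n \<and> u \<noteq> v \<and> (v \<in> s u \<or> u \<in> s v)}"
    by (rule finite_subset[of _ "{..<n} \<times> {..<n}"]) auto
  then show ?thesis
    by unfold_locales (auto simp: channel_graph_def symmetric_def intro: symI)
qed

definition graph_dist :: "'a pair_pre_digraph \<Rightarrow> 'a \<Rightarrow> 'a \<Rightarrow> ereal" where
  "graph_dist G u v = wf_digraph.\<mu> (with_proj G) (\<lambda>_. 1) u v"

definition shortest_paths :: "'a pair_pre_digraph \<Rightarrow> 'a \<Rightarrow> 'a \<Rightarrow> ('a \<times> 'a) awalk set" where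
  "shortest_paths G i j =
     {p. pre_digraph.apath (with_proj G) i p j \<and> ereal (real (length p)) = graph_dist G i j}"

definition num_shortest_paths :: "'a pair_pre_digraph \<Rightarrow> 'a \<Rightarrow> 'a \<Rightarrow> nat" where
  "num_shortest_paths G i j = card (shortest_paths G i j)"

definition num_shortest_paths_through :: "'a pair_pre_digraph \<Rightarrow> 'a \<Rightarrow> 'a \<Rightarrow> 'a \<Rightarrow> nat" where
  "num_shortest_paths_through G u i j =
     card {p \<in> shortest_paths G i j. u \<in> set (pawalk_verts i p)}"

definition betweenness :: "nat \<Rightarrow> (nat \<Rightarrow> nat set) \<Rightarrow> nat \<Rightarrow> real" where
  "betweenness n s u =
     (let G = channel_graph n s in
       (real n - 1) * (real n - 2) -
       (\<Sum>(i, j) \<in> {(i, j). i < n \<and> j < n \<and> i \<noteq> j \<and> i \<noteq> u \<and> j \<noteq> u \<and> num_shortest_paths G i j > 0}.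
          real (num_shortest_paths_through G u i j) / real (num_shortest_paths G i j)))"

definition closeness :: "nat \<Rightarrow> (nat \<Rightarrow> nat set) \<Rightarrow> nat \<Rightarrow> ereal" where
  "closeness n s u = (\<Sum>v \<in> {..<n} - {u}. graph_dist (channel_graph n s) u v - 1)"

definition cost :: "nat \<Rightarrow> real \<Rightarrow> real \<Rightarrow> (nat \<Rightarrow> nat set) \<Rightarrow> nat \<Rightarrow> ereal" where
  "cost n b c s u =
     ereal (real (card (s u))) + ereal b * ereal (betweenness n s u) + ereal c * closeness n s u"

definition nash_equilibrium :: "nat \<Rightarrow> real \<Rightarrow> real \<Rightarrow> (nat \<Rightarrow> nat set) \<Rightarrow> bool" where
  "nash_equilibrium n b c s \<longleftrightarrow>
     strategy_combination n s \<and>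
     (\<forall>u<n. \<forall>t \<in> strategies n u. \<not> cost n b c (s(u := t)) u < cost n b c s u)"

text \<open>
  The vertices can be listed without repetition so that the edges are exactly the pairs of
  consecutive list elements.
\<close>

definition path_graph :: "'a pair_pre_digraph \<Rightarrow> bool" where
  "path_graph G \<longleftrightarrow>
     (\<exists>xs. xs \<noteq> [] \<and> distinct xs \<and> pverts G = set xs \<and>
           parcs G = set (vwalk_arcs xs) \<union> (set (vwalk_arcs xs))\<inverse>)"

end

theory Submission
  imports Defs
begin

text \<open>
  Let the path be \<open>x\<^sub>0, \<dots>, x\<^bsub>n-1\<^esub>\<close>. If \<open>x\<^sub>i\<close> pays for the channel to \<open>x\<^bsub>i+1\<^esub>\<close> and \<open>i + 3 < n\<close>, then
  \<open>x\<^sub>i\<close> gains by redirecting it to \<open>x\<^bsub>i+2\<^esub>\<close> (or by dropping it, if \<open>x\<^bsub>i+1\<^esub>\<close> pays for it too): her degree is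
  unchanged, she still separates the vertices before her from those after her, only
  \<open>x\<^bsub>i+1\<^esub>\<close> moves away, by 1, and at least \<open>x\<^bsub>i+2\<^esub>\<close> and \<open>x\<^bsub>i+3\<^esub>\<close> come closer by 1. For \<open>n \<ge> 6\<close>
  the channel between \<open>x\<^sub>2\<close> and \<open>x\<^sub>3\<close> can be paid for by neither end: \<open>x\<^sub>2\<close> would redirect it
  forwards and, reading the path in reverse, \<open>x\<^sub>3\<close> would redirect it backwards.
\<close>

section \<open>Betweenness as a sum over all ordered pairs\<close>

definition transit_ratio :: "'a pair_pre_digraph \<Rightarrow> 'a \<Rightarrow> 'a \<Rightarrow> 'a \<Rightarrow> real" where
  "transit_ratio G u i j =
     real (num_shortest_paths_through G u i j) / real (num_shortest_paths G i j)"

definition other_pairs :: "nat \<Rightarrow> nat \<Rightarrow> (nat \<times> nat) set" where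
  "other_pairs n u = {(i, j). i < n \<and> j < n \<and> i \<noteq> j \<and> i \<noteq> u \<and> j \<noteq> u}"

lemma finite_other_pairs: "finite (other_pairs n u)"
  by (rule finite_subset[of _ "{..<n} \<times> {..<n}"]) (auto simp: other_pairs_def)

text \<open>Pairs without shortest path may be added to the sum because they contribute \<open>0 / 0 = 0\<close>.\<close>

lemma betweenness_eq_sum_transit_ratio:
  "betweenness n s u =
     (real n - 1) * (real n - 2) - (\<Sum>(i, j) \<in> other_pairs n u. transit_ratio (channel_graph n s) u i j)"
proof -
  let ?G = "channel_graph n s"
  have "(\<Sum>(i, j) \<in> {(i, j). i < n \<and> j < n \<and> i \<noteq> j \<and> i \<noteq> u \<and> j \<noteq> u \<and> num_shortest_paths ?G i j > 0}.
           transit_ratio ?G u i j)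
      = (\<Sum>(i, j) \<in> other_pairs n u. transit_ratio ?G u i j)"
    by (rule sum.mono_neutral_left)
      (use finite_other_pairs[of n u] in \<open>auto simp: other_pairs_def transit_ratio_def\<close>)
  then show ?thesis
    by (simp add: betweenness_def transit_ratio_def Let_def)
qed

section \<open>Walks, distances and separation in a symmetric graph\<close>

context pair_graph
begin

lemma graph_dist_le_length:
  assumes "awalk u p v"
  shows "graph_dist G u v \<le> ereal (real (length p))"
proof -
  have "awalk_cost (\<lambda>_. 1) p = real (length p)"
    by (induction p) auto
  with min_cost_le_walk_cost[OF assms, of "\<lambda>_. 1"] show ?thesis
    by (simp add: graph_dist_def)
qed

lemma shortest_path_exists:
  assumes "u \<rightarrow>\<^sup>*\<^bsub>with_proj G\<^esub> v"
  obtains p where "p \<in> shortest_paths G u v"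
proof -
  from min_cost_awalk[OF assms, of "\<lambda>_. 1"]
  obtain p where p: "apath u p v" "\<mu> (\<lambda>_. 1) u v = awalk_cost (\<lambda>_. 1) p"
    by auto
  have "awalk_cost (\<lambda>_. 1) p = real (length p)"
    by (induction p) auto
  with p show thesis
    by (intro that) (simp add: shortest_paths_def graph_dist_def)
qed

lemma finite_shortest_paths: "finite (shortest_paths G u v)"
  by (rule finite_subset[OF _ apaths_finite[of u v]]) (auto simp: shortest_paths_def)

lemma num_shortest_paths_pos:
  assumes "u \<rightarrow>\<^sup>*\<^bsub>with_proj G\<^esub> v"
  shows "num_shortest_paths G u v > 0"
  using shortest_path_exists[OF assms] finite_shortest_paths
  by (auto simp: num_shortest_paths_def card_gt_0_iff)

lemma transit_ratio_le_1: "transit_ratio G w u v \<le> 1"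
proof -
  have "num_shortest_paths_through G w u v \<le> num_shortest_paths G u v"
    unfolding num_shortest_paths_through_def num_shortest_paths_def
    by (rule card_mono[OF finite_shortest_paths]) auto
  then show ?thesis
    by (auto simp: transit_ratio_def divide_le_eq_1)
qed

lemma transit_ratio_nonneg: "transit_ratio G w u v \<ge> 0"
  by (simp add: transit_ratio_def)

text \<open>Each arc changes \<open>f\<close> by at most 1. With \<open>f\<close> the position on a
  path this yields the lower bounds on distances.\<close>

lemma lipschitz_le_length:
  fixes f :: "'a \<Rightarrow> int"
  assumes "awalk u p v" and "\<And>v w. (v, w) \<in> parcs G \<Longrightarrow> \<bar>f v - f w\<bar> \<le> 1"
  shows "\<bar>f u - f v\<bar> \<le> int (length p)"
  using assms(1)
proof (induction p arbitrary: u)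
  case Nil
  then show ?case by (simp add: awalk_Nil_iff)
next
  case (Cons e p)
  then have "(u, snd e) \<in> parcs G" "awalk (snd e) p v"
    by (auto simp: awalk_Cons_iff)
  with Cons.IH[of "snd e"] assms(2)[of u "snd e"] show ?case
    by simp
qed

text \<open>A walk from inside \<open>S\<close> to outside has a first arc leaving \<open>S\<close>,
  and that arc must end in \<open>c\<close>.\<close>

lemma awalk_leaves_through:
  assumes "awalk u p v" and "u \<in> S" "v \<notin> S"
    and "\<And>v w. (v, w) \<in> parcs G \<Longrightarrow> v \<in> S \<Longrightarrow> w \<notin> S \<Longrightarrow> w = c"
  shows "c \<in> set (pawalk_verts u p)"
  using assms(1-3)
proof (induction p arbitrary: u)
  case Nil
  then show ?case by (auto simp: awalk_Nil_iff)
next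
  case (Cons e p)
  then have e: "(u, snd e) \<in> parcs G" "awalk (snd e) p v"
    by (auto simp: awalk_Cons_iff)
  show ?case
  proof (cases "snd e \<in> S")
    case True
    with Cons e show ?thesis by simp
  next
    case False
    with assms(4) e Cons.prems(2) have "snd e = c" by blast
    moreover have "snd e \<in> set (pawalk_verts (snd e) p)"
      using hd_in_awalk_verts(1)[OF e(2)] .
    ultimately show ?thesis by simp
  qed
qed

text \<open>Every walk from \<open>u\<close> to \<open>v\<close> leaves \<open>S\<close> and
  therefore meets \<open>c\<close>. Reachability supplies a shortest path, without which the ratio
  would be \<open>0 / 0 = 0\<close>.\<close>

lemma transit_ratio_eq_1:
  assumes "u \<rightarrow>\<^sup>*\<^bsub>with_proj G\<^esub> v" and "u \<in> S" "v \<notin> S"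
    and "\<And>v w. (v, w) \<in> parcs G \<Longrightarrow> v \<in> S \<Longrightarrow> w \<notin> S \<Longrightarrow> w = c"
  shows "transit_ratio G c u v = 1"
proof -
  have "c \<in> set (pawalk_verts u p)" if "p \<in> shortest_paths G u v" for p
    using that awalk_leaves_through[OF _ assms(2-4)]
    by (auto simp: shortest_paths_def apath_def)
  then have "{p \<in> shortest_paths G u v. c \<in> set (pawalk_verts u p)} = shortest_paths G u v"
    by auto
  with num_shortest_paths_pos[OF assms(1)] show ?thesis
    by (simp add: transit_ratio_def num_shortest_paths_def num_shortest_paths_through_def)
qed

text \<open>Localised to an interval of positions so that it applies both to a whole path and to the
  pieces that stay intact after an edge has been removed.\<close>

lemma segment_walk:
  fixes pos :: "'a \<Rightarrow> nat"
  assumes seg: "{lo..hi} \<subseteq> pos ` pverts G"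
    and adj: "\<And>v w. \<lbrakk>v \<in> pverts G; w \<in> pverts G; pos v \<in> {lo..hi}; pos w \<in> {lo..hi};
                 pos v = Suc (pos w) \<or> pos w = Suc (pos v)\<rbrakk> \<Longrightarrow> (v, w) \<in> parcs G"
    and inj: "inj_on pos (pverts G)"
    and "v \<in> pverts G" "w \<in> pverts G" "pos v \<in> {lo..hi}" "pos w \<in> {lo..hi}"
    and "\<bar>int (pos v) - int (pos w)\<bar> = int k"
  shows "\<exists>p. awalk v p w \<and> length p = k"
  using assms(4-)
proof (induction k arbitrary: v)
  case 0
  then have "v = w" using inj by (auto dest: inj_onD)
  with 0 show ?case by (auto simp: awalk_Nil_iff)
next
  case (Suc k)
  \<comment> \<open>One step from \<open>v\<close> towards \<open>w\<close>: \<open>m\<close> lies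
    between the two positions and hence stays in the interval.\<close>
  define m where "m = (if pos v < pos w then Suc (pos v) else pos v - 1)"
  have m: "m \<in> {lo..hi}" "pos v = Suc m \<or> m = Suc (pos v)" "\<bar>int m - int (pos w)\<bar> = int k"
    using Suc.prems by (auto simp: m_def)
  from m(1) seg obtain x where x: "x \<in> pverts G" "pos x = m" by auto
  from Suc.IH[of x] x m Suc.prems obtain p where p: "awalk x p w" "length p = k"
    by auto
  moreover have "(v, x) \<in> parcs G"
    using adj[of v x] x m Suc.prems by simp
  ultimately have "awalk v ((v, x) # p) w"
    by (simp add: awalk_Cons_iff)
  with p show ?case by (intro exI[of _ "(v, x) # p"]) simp
qed

end

section \<open>Paths whose vertices are numbered consecutively\<close>

locale numbered_path = pair_graph G for G :: "'a pair_pre_digraph" (structure) +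
  fixes pos :: "'a \<Rightarrow> nat"
  assumes bij_pos: "bij_betw pos (pverts G) {..<card (pverts G)}"
    and arc_iff: "\<And>v w. \<lbrakk>v \<in> pverts G; w \<in> pverts G\<rbrakk> \<Longrightarrow>
      (v, w) \<in> parcs G \<longleftrightarrow> pos v = Suc (pos w) \<or> pos w = Suc (pos v)"
begin

lemma pos_less: "v \<in> pverts G \<Longrightarrow> pos v < card (pverts G)"
  using bij_pos by (auto simp: bij_betw_def)

lemma ex_pos:
  assumes "k < card (pverts G)"
  obtains v where "v \<in> pverts G" "pos v = k"
proof -
  have "k \<in> pos ` pverts G" using bij_pos assms by (auto simp: bij_betw_def)
  with that show thesis by blast
qed

lemma inj_pos: "inj_on pos (pverts G)"
  using bij_pos by (auto simp: bij_betw_def)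

lemma pos_diff_le_length:
  assumes "awalk v p w"
  shows "\<bar>int (pos v) - int (pos w)\<bar> \<le> int (length p)"
proof (rule lipschitz_le_length[OF assms, where f = "\<lambda>v. int (pos v)"])
  fix v w assume a: "(v, w) \<in> parcs G"
  then have "v \<in> pverts G" "w \<in> pverts G"
    using in_arcsD1 in_arcsD2 by auto
  with arc_iff a have "pos v = Suc (pos w) \<or> pos w = Suc (pos v)" by blast
  then show "\<bar>int (pos v) - int (pos w)\<bar> \<le> 1" by auto
qed

lemma ex_walk:
  assumes "v \<in> pverts G" "w \<in> pverts G" "\<bar>int (pos v) - int (pos w)\<bar> = int k"
  shows "\<exists>p. awalk v p w \<and> length p = k"
proof (rule segment_walk[where lo = 0 and hi = "card (pverts G) - 1"])
  show "{0..card (pverts G) - 1} \<subseteq> pos ` pverts G"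
    using bij_pos pos_less[OF assms(1)] by (auto simp: bij_betw_def)
  show "pos v \<in> {0..card (pverts G) - 1}" "pos w \<in> {0..card (pverts G) - 1}"
    using pos_less[of v] pos_less[of w] assms by auto
qed (use assms inj_pos in \<open>simp_all add: arc_iff\<close>)

text \<open>The walk along the numbering gives the upper bound; the lower bound holds because no arc
  changes the position by more than 1.\<close>

lemma graph_dist_eq:
  assumes "v \<in> pverts G" "w \<in> pverts G"
  shows "graph_dist G v w = ereal \<bar>real (pos v) - real (pos w)\<bar>"
proof -
  define k where "k = nat \<bar>int (pos v) - int (pos w)\<bar>"
  have k: "\<bar>real (pos v) - real (pos w)\<bar> = real k"
    by (auto simp: k_def)
  have k': "\<bar>int (pos v) - int (pos w)\<bar> = int k"
    by (auto simp: k_def)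
  from ex_walk[OF assms k'] obtain p where p: "awalk v p w" "length p = k"
    by auto
  then have "graph_dist G v w \<le> ereal (real k)"
    using graph_dist_le_length by blast
  moreover obtain q where "q \<in> shortest_paths G v w"
    using shortest_path_exists reachable_awalkI[OF p(1)] by blast
  then have "awalk v q w" "graph_dist G v w = ereal (real (length q))"
    by (auto simp: shortest_paths_def apath_def)
  moreover from pos_diff_le_length[OF this(1)] k' have "k \<le> length q" by simp
  ultimately show ?thesis by (simp add: k)
qed

text \<open>A detour through \<open>u\<close> costs at least the sum of the two distances to
  \<open>u\<close>, which exceeds the distance from \<open>v\<close> to \<open>w\<close> when both
  lie strictly on the same side of \<open>u\<close>.\<close>

lemma transit_ratio_eq_0:
  assumes "v \<in> pverts G" "w \<in> pverts G"
    and "pos v < pos u \<and> pos w < pos u \<or> pos v > pos u \<and> pos w > pos u"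
  shows "transit_ratio G u v w = 0"
proof -
  have False if p: "p \<in> shortest_paths G v w" "u \<in> set (pawalk_verts v p)" for p
  proof -
    from p(1) have "awalk v p w" and len: "ereal (real (length p)) = graph_dist G v w"
      by (auto simp: shortest_paths_def apath_def)
    with p(2) obtain q r where "p = q @ r" "awalk v q u" "awalk u r w"
      using awalk_decomp by blast
    with pos_diff_le_length[of v q u] pos_diff_le_length[of u r w]
    have "\<bar>int (pos v) - int (pos u)\<bar> + \<bar>int (pos u) - int (pos w)\<bar> \<le> int (length p)"
      by simp
    moreover from len have "int (length p) = \<bar>int (pos v) - int (pos w)\<bar>"
      using graph_dist_eq[OF assms(1,2)] by auto
    ultimately show False using assms(3) by linarith
  qed
  then have "{p \<in> shortest_paths G v w. u \<in> set (pawalk_verts v p)} = {}" by blast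
  then show ?thesis by (simp only: transit_ratio_def num_shortest_paths_through_def) simp
qed

text \<open>This symmetry lets an argument about channels towards larger positions also cover
  channels towards smaller ones.\<close>

lemma numbered_path_reverse: "numbered_path G (\<lambda>v. card (pverts G) - 1 - pos v)"
proof unfold_locales
  have "bij_betw (\<lambda>k. card (pverts G) - 1 - k) {..<card (pverts G)} {..<card (pverts G)}"
    by (rule bij_betw_byWitness[where f' = "\<lambda>k. card (pverts G) - 1 - k"]) auto
  from bij_betw_trans[OF bij_pos this]
  show "bij_betw (\<lambda>v. card (pverts G) - 1 - pos v) (pverts G) {..<card (pverts G)}"
    by (simp add: comp_def)
next
  fix v w assume vw: "v \<in> pverts G" "w \<in> pverts G"
  have "c - 1 - k = Suc (c - 1 - l) \<longleftrightarrow> l = Suc k" if "k < c" "l < c" for c k l :: nat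
    using that by linarith
  from this[of "pos v" "card (pverts G)" "pos w"] this[of "pos w" "card (pverts G)" "pos v"]
  show "(v, w) \<in> parcs G \<longleftrightarrow>
      card (pverts G) - 1 - pos v = Suc (card (pverts G) - 1 - pos w) \<or>
      card (pverts G) - 1 - pos w = Suc (card (pverts G) - 1 - pos v)"
    using arc_iff[OF vw] pos_less[OF vw(1)] pos_less[OF vw(2)] by blast
qed

end

section \<open>From the list of vertices to a numbering\<close>

lemma set_vwalk_arcs_nth: "set (vwalk_arcs xs) = {(xs ! k, xs ! Suc k) |k. Suc k < length xs}"
proof (induction xs rule: vwalk_arcs.induct)
  case (3 x y xs)
  have "{((x # y # xs) ! k, (x # y # xs) ! Suc k) |k. Suc k < length (x # y # xs)}
      = insert (x, y) {((y # xs) ! k, (y # xs) ! Suc k) |k. Suc k < length (y # xs)}"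
    (is "?A = ?B")
  proof (intro equalityI subsetI)
    fix e assume "e \<in> ?A"
    then obtain k where "e = ((x # y # xs) ! k, (x # y # xs) ! Suc k)" "Suc k < length (x # y # xs)"
      by blast
    then show "e \<in> ?B" by (cases k) auto
  next
    fix e assume "e \<in> ?B"
    then consider "e = (x, y)"
      | k where "e = ((y # xs) ! k, (y # xs) ! Suc k)" "Suc k < length (y # xs)" by blast
    then show "e \<in> ?A"
    proof cases
      case 1 then show ?thesis by (auto intro!: exI[of _ 0])
    next
      case 2 then show ?thesis by (auto intro!: exI[of _ "Suc k"])
    qed
  qed
  with 3 show ?case by simp
qed auto

lemma path_graph_numbered_path:
  assumes "pair_graph G" "path_graph G"
  shows "\<exists>pos. numbered_path G pos"
proof -
  interpret pair_graph G by fact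
  from assms(2) obtain xs where xs: "distinct xs" "pverts G = set xs"
    "parcs G = set (vwalk_arcs xs) \<union> (set (vwalk_arcs xs))\<inverse>"
    by (auto simp: path_graph_def)
  have card: "card (pverts G) = length xs"
    using xs by (simp add: distinct_card)
  have bij: "bij_betw ((!) xs) {..<length xs} (pverts G)"
    using xs by (simp add: bij_betw_nth)
  \<comment> \<open>The position of a vertex is its index in the list, unique by
    distinctness.\<close>
  define pos where "pos = the_inv_into {..<length xs} ((!) xs)"
  have pos_nth: "pos (xs ! k) = k" if "k < length xs" for k
    using that bij by (auto simp: pos_def bij_betw_def the_inv_into_f_f)
  have "bij_betw pos (pverts G) {..<card (pverts G)}"
    unfolding pos_def card by (rule bij_betw_the_inv_into[OF bij])
  moreover have "(v, w) \<in> parcs G \<longleftrightarrow> pos v = Suc (pos w) \<or> pos w = Suc (pos v)"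
    if vw: "v \<in> pverts G" "w \<in> pverts G" for v w
  proof -
    from vw xs obtain k l where "v = xs ! k" "w = xs ! l" "k < length xs" "l < length xs"
      by (auto simp: in_set_conv_nth)
    then show ?thesis
      using xs(1) by (auto simp: xs(3) set_vwalk_arcs_nth pos_nth nth_eq_iff_index_eq)
  qed
  ultimately have "numbered_path G pos"
    by unfold_locales auto
  then show ?thesis by blast
qed

section \<open>The profitable deviation\<close>

lemma pverts_channel_graph [simp]: "pverts (channel_graph n s) = {..<n}"
  by (simp add: channel_graph_def)

text \<open>An upper bound on the new closeness suffices, so the distances after a deviation need
  not be determined exactly. Finiteness of both bounds moves the comparison from
  \<open>ereal\<close> to \<open>real\<close>.\<close>

lemma cost_less:
  assumes "closeness n s u = ereal C" "closeness n s' u \<le> ereal C'" and "c > 0"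
    and "real (card (s' u)) + b * betweenness n s' u + c * C'
       < real (card (s u)) + b * betweenness n s u + c * C"
  shows "cost n b c s' u < cost n b c s u"
proof -
  have "ereal c * closeness n s' u \<le> ereal (c * C')"
    using ereal_mult_left_mono[OF assms(2), of "ereal c"] assms(3) by simp
  then have "cost n b c s' u \<le> ereal (real (card (s' u)) + b * betweenness n s' u) + ereal (c * C')"
    unfolding cost_def by (simp add: add_left_mono del: plus_ereal.simps flip: plus_ereal.simps(1))
  also have "\<dots> < cost n b c s u"
    using assms(1,4) by (simp add: cost_def)
  finally show ?thesis .
qed

lemma no_forward_owner:
  assumes path: "numbered_path (channel_graph n s) pos"
    and nash: "nash_equilibrium n b c s" and "b \<ge> 0" "c > 0"
    and "u < n" "y < n" "y \<in> s u" "pos y = Suc (pos u)" "pos u + 3 < n"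
  shows False
proof -
  let ?G = "channel_graph n s"
  interpret P: numbered_path ?G pos by fact
  have strat: "s u \<subseteq> {..<n} - {u}"
    using nash \<open>u < n\<close> by (auto simp: nash_equilibrium_def strategy_combination_def strategies_def)
  then have fin: "finite (s u)" by (rule finite_subset) simp
  have no_deviation: "\<not> cost n b c (s(u := t)) u < cost n b c s u" if "t \<subseteq> {..<n} - {u}" for t
    using nash \<open>u < n\<close> that by (auto simp: nash_equilibrium_def strategies_def)
  define C where "C = (\<Sum>v\<in>{..<n} - {u}. \<bar>real (pos u) - real (pos v)\<bar> - 1)"
  have C: "closeness n s u = ereal C"
    unfolding closeness_def C_def sum_ereal[symmetric]
    by (rule sum.cong) (use P.graph_dist_eq[of u] \<open>u < n\<close> in \<open>auto simp: one_ereal_def\<close>)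
  \<comment> \<open>Otherwise dropping \<open>y\<close> saves a channel and leaves the graph
    unchanged. Later this fact ensures that the redirection really removes the edge between
    \<open>u\<close> and \<open>y\<close>.\<close>
  have "u \<notin> s y"
  proof
    assume "u \<in> s y"
    define s' where "s' = s(u := s u - {y})"
    have same: "channel_graph n s' = ?G"
      using \<open>u \<in> s y\<close> \<open>y \<in> s u\<close> by (auto simp: channel_graph_def s'_def split: if_splits)
    have "card (s' u) < card (s u)"
      using card_Diff1_less[OF fin \<open>y \<in> s u\<close>] by (simp add: s'_def)
    then have "cost n b c s' u < cost n b c s u"
      using C \<open>c > 0\<close> by (intro cost_less[of n s u C s' C])
        (simp_all add: betweenness_def closeness_def same)
    with no_deviation[of "s u - {y}"] strat show False
      by (auto simp: s'_def)
  qed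
  obtain z where z: "z < n" "pos z = pos u + 2"
    using P.ex_pos[of "pos u + 2"] \<open>pos u + 3 < n\<close> by auto
  obtain x where x: "x < n" "pos x = pos u + 3"
    using P.ex_pos[of "pos u + 3"] \<open>pos u + 3 < n\<close> by auto
  \<comment> \<open>Positions at distance 2 are not adjacent, so \<open>z\<close> is not yet in
    \<open>s u\<close> and exchanging \<open>y\<close> for \<open>z\<close> keeps the number of
    channels.\<close>
  have uz: "(u, z) \<notin> parcs ?G" and uy: "u \<noteq> y" and yz: "y \<noteq> z"
    using P.arc_iff[of u z] \<open>u < n\<close> z \<open>pos y = Suc (pos u)\<close> by auto
  then have z_new: "z \<notin> s u" "u \<noteq> z"
    using z \<open>u < n\<close> by (auto simp: channel_graph_def)
  define s' where "s' = s(u := insert z (s u - {y}))"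
  let ?H = "channel_graph n s'"
  interpret H: pair_graph ?H by (rule pair_graph_channel_graph)
  have parcs_H: "parcs ?H = (parcs ?G - {(u, y), (y, u)}) \<union> {(u, z), (z, u)}"
    using \<open>u \<notin> s y\<close> uy yz z_new \<open>u < n\<close> z
    by (auto simp: channel_graph_def s'_def split: if_splits)
  have arc_H: "(v, w) \<in> parcs ?H \<longleftrightarrow>
      (v, w) \<in> {(u, z), (z, u)} \<or> (v, w) \<notin> {(u, y), (y, u)} \<and>
      (pos v = Suc (pos w) \<or> pos w = Suc (pos v))" if "v < n" "w < n" for v w
    using P.arc_iff[of v w] that by (auto simp: parcs_H)
  \<comment> \<open>The only lost edge joins positions \<open>pos u\<close> and
    \<open>pos u + 1\<close>, so the intervals up to \<open>pos u\<close> and from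
    \<open>pos u + 2\<close> on are still pieces of the path.\<close>
  have seg_H: "\<exists>p. H.awalk v p w \<and> length p = k"
    if "v < n" "w < n" "pos v \<in> {lo..hi}" "pos w \<in> {lo..hi}"
      "\<bar>int (pos v) - int (pos w)\<bar> = int k" "hi < n" "hi \<le> pos u \<or> lo \<ge> pos u + 2" for v w lo hi k
  proof (rule H.segment_walk[where lo = lo and hi = hi and pos = pos])
    show "{lo..hi} \<subseteq> pos ` pverts ?H"
      using P.bij_pos \<open>hi < n\<close> by (auto simp: bij_betw_def)
    show "inj_on pos (pverts ?H)" using P.inj_pos by simp
    show "(v, w) \<in> parcs ?H"
      if "v \<in> pverts ?H" "w \<in> pverts ?H" "pos v \<in> {lo..hi}" "pos w \<in> {lo..hi}"
        "pos v = Suc (pos w) \<or> pos w = Suc (pos v)" for v w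
      using that \<open>hi \<le> pos u \<or> lo \<ge> pos u + 2\<close> \<open>pos y = Suc (pos u)\<close> arc_H[of v w] by auto
  qed (use that in auto)
  \<comment> \<open>\<open>e\<close> bounds the distances from \<open>u\<close> after the deviation.\<close>
  define e where "e v = (if pos v \<le> pos u then pos u - pos v
      else if v = y then 2 else pos v - Suc (pos u))" for v
  have pos_eq: "v = w" if "v < n" "w < n" "pos v = pos w" for v w
    using P.inj_pos that by (auto dest: inj_onD)
  have walk_H: "\<exists>p. H.awalk u p v \<and> length p = e v" if vn: "v < n" for v
  proof (cases "pos v \<le> pos u")
    case True
    then show ?thesis
      using seg_H[of u v 0 "pos u" "e v"] \<open>u < n\<close> vn \<open>pos u + 3 < n\<close> by (auto simp: e_def)
  next
    case False
    show ?thesis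
    proof (cases "v = y")
      case True
      \<comment> \<open>\<open>y\<close> loses its edge to \<open>u\<close> but keeps the one to
        \<open>z\<close>, hence the value 2 of \<open>e y\<close>.\<close>
      have "(u, z) \<in> parcs ?H" "(z, y) \<in> parcs ?H"
        using arc_H[of u z] arc_H[of z y] z \<open>u < n\<close> \<open>y < n\<close> \<open>pos y = Suc (pos u)\<close> uy z_new by auto
      then have "H.awalk u [(u, z), (z, y)] y"
        using \<open>y < n\<close> by (simp add: H.awalk_simps)
      with True False show ?thesis by (intro exI[of _ "[(u, z), (z, y)]"]) (simp add: e_def)
    next
      case neq: False
      then have "pos v \<noteq> Suc (pos u)"
        using pos_eq[of v y] vn \<open>y < n\<close> \<open>pos y = Suc (pos u)\<close> by auto
      with False have ge: "pos v \<ge> pos u + 2" by simp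
      have "pos v < n" using P.pos_less[of v] vn by simp
      then obtain p where p: "H.awalk z p v" "length p = pos v - (pos u + 2)"
        using seg_H[of z v "pos u + 2" "pos v" "pos v - (pos u + 2)"] z vn ge by auto
      have "(u, z) \<in> parcs ?H" by (simp add: parcs_H)
      with p have "H.awalk u ((u, z) # p) v" by (simp add: H.awalk_Cons_iff)
      with p ge neq show ?thesis by (intro exI[of _ "(u, z) # p"]) (simp add: e_def)
    qed
  qed
  \<comment> \<open>All vertices are connected through \<open>u\<close>;
    \<open>transit_ratio_eq_1\<close> requires this.\<close>
  have reach_H: "v \<rightarrow>\<^sup>*\<^bsub>with_proj ?H\<^esub> w" if "v < n" "w < n" for v w
  proof -
    have "u \<rightarrow>\<^sup>*\<^bsub>with_proj ?H\<^esub> v" "u \<rightarrow>\<^sup>*\<^bsub>with_proj ?H\<^esub> w"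
      using walk_H that H.reachable_awalkI by blast+
    then show ?thesis
      by (meson H.symmetric_reachable' H.reachable_trans)
  qed

  define C' where "C' = (\<Sum>v\<in>{..<n} - {u}. real (e v) - 1)"
  have C'_ge: "closeness n s' u \<le> ereal C'"
    unfolding closeness_def C'_def sum_ereal[symmetric]
  proof (rule sum_mono)
    fix v assume "v \<in> {..<n} - {u}"
    then obtain p where "H.awalk u p v" "length p = e v"
      using walk_H by auto
    then have "graph_dist ?H u v \<le> ereal (real (e v))"
      using H.graph_dist_le_length by metis
    then have "graph_dist ?H u v - 1 \<le> ereal (real (e v)) - 1"
      by (rule ereal_minus_mono) simp
    then show "graph_dist ?H u v - 1 \<le> ereal (real (e v) - 1)"
      by (simp add: one_ereal_def)
  qed
  \<comment> \<open>The correction terms record that \<open>y\<close> moves from distance 1 to 2,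
    \<open>z\<close> from 2 to 1 and \<open>x\<close> from 3 to 2. Vertices beyond \<open>x\<close>
    also come closer, but this gain is discarded. The total change is at most
    \<open>1 - 1 - 1 = -1\<close>.\<close>
  have "C' \<le> (\<Sum>v\<in>{..<n} - {u}. (\<bar>real (pos u) - real (pos v)\<bar> - 1)
      + (if v = y then 1 else 0) - (if v = z then 1 else 0) - (if v = x then 1 else 0))"
    unfolding C'_def
  proof (rule sum_mono)
    fix v assume "v \<in> {..<n} - {u}"
    then have "v < n" by simp
    have xyz: "pos y = pos u + 1" "pos z = pos u + 2" "pos x = pos u + 3"
      using \<open>pos y = Suc (pos u)\<close> z x by simp_all
    consider "pos v \<le> pos u" "v \<noteq> y" "v \<noteq> z" "v \<noteq> x"
      | "v = y" "v \<noteq> z" "v \<noteq> x"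
      | "pos v \<ge> pos u + 2" "v \<noteq> y"
    proof (cases "pos v \<le> pos u")
      case True
      with xyz that(1) show thesis by fastforce
    next
      case False
      with pos_eq[OF \<open>v < n\<close> \<open>y < n\<close>] xyz that(2,3) show thesis
        by (cases "v = y") fastforce+
    qed
    then show "real (e v) - 1 \<le> (\<bar>real (pos u) - real (pos v)\<bar> - 1)
      + (if v = y then 1 else 0) - (if v = z then 1 else 0) - (if v = x then 1 else 0)"
    proof cases
      case 3
      with xyz show ?thesis by (cases "v = z"; cases "v = x") (simp_all add: e_def)
    qed (use xyz in \<open>simp_all add: e_def\<close>)
  qed
  also have "\<dots> = C - 1"
    using \<open>y < n\<close> x z uy z_new by (simp add: C_def sum.distrib sum_subtractf) auto
  finally have C'_less: "C' < C" by simp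

  \<comment> \<open>No ratio drops: for a pair on the same side of \<open>u\<close> it was 0 on the
    path, and for a pair on opposite sides it is 1 after the deviation.\<close>
  have ratio_le: "transit_ratio ?G u i j \<le> transit_ratio ?H u i j"
    if ij: "i < n" "j < n" "i \<noteq> u" "j \<noteq> u" for i j
  proof -
    have neq: "pos i \<noteq> pos u" "pos j \<noteq> pos u"
      using pos_eq ij \<open>u < n\<close> by blast+
    have arc_less: "v < n" "w < n" if "(v, w) \<in> parcs ?H" for v w
      using that by (auto simp: channel_graph_def)
    consider (same) "pos i < pos u \<and> pos j < pos u \<or> pos i > pos u \<and> pos j > pos u"
      | (up) "pos i < pos u" "pos j > pos u" | (down) "pos i > pos u" "pos j < pos u"
      using neq by linarith
    then show ?thesis
    proof cases
      case same
      then show ?thesis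
        using P.transit_ratio_eq_0[of i j u] H.transit_ratio_nonneg ij by simp
    next
      case up
      have "transit_ratio ?H u i j = 1"
      \<comment> \<open>The new edge joins \<open>u\<close> and \<open>z\<close>, both outside this
        set, so arcs leaving the set still end in \<open>u\<close>.\<close>
      proof (rule H.transit_ratio_eq_1[OF reach_H[OF ij(1,2)], where S = "{v. pos v < pos u}"])
        fix v w assume *: "(v, w) \<in> parcs ?H" "v \<in> {v. pos v < pos u}" "w \<notin> {v. pos v < pos u}"
        then show "w = u"
          using arc_less[OF *(1)] arc_H[of v w] pos_eq[of w u] \<open>u < n\<close> z by auto
      qed (use up in auto)
      then show ?thesis using P.transit_ratio_le_1 by simp
    next
      case down
      have "transit_ratio ?H u i j = 1"
      \<comment> \<open>Here the new arc from \<open>z\<close> does leave the set, but it ends in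
        \<open>u\<close> as well.\<close>
      proof (rule H.transit_ratio_eq_1[OF reach_H[OF ij(1,2)], where S = "{v. pos v > pos u}"])
        fix v w assume *: "(v, w) \<in> parcs ?H" "v \<in> {v. pos v > pos u}" "w \<notin> {v. pos v > pos u}"
        then show "w = u"
          using arc_less[OF *(1)] arc_H[of v w] pos_eq[of w u] \<open>u < n\<close> z by auto
      qed (use down in auto)
      then show ?thesis using P.transit_ratio_le_1 by simp
    qed
  qed
  have "betweenness n s' u \<le> betweenness n s u"
    unfolding betweenness_eq_sum_transit_ratio
    by (intro diff_left_mono sum_mono) (auto simp: other_pairs_def intro: ratio_le)
  then have "b * betweenness n s' u \<le> b * betweenness n s u"
    using \<open>b \<ge> 0\<close> by (rule mult_left_mono)
  moreover have "card (s' u) = card (s u)"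
    using z_new \<open>y \<in> s u\<close> fin card_Suc_Diff1[OF fin \<open>y \<in> s u\<close>] by (simp add: s'_def)
  moreover have "c * C' < c * C"
    using C'_less \<open>c > 0\<close> by simp
  ultimately have "cost n b c s' u < cost n b c s u"
    by (intro cost_less[OF C C'_ge \<open>c > 0\<close>]) linarith
  moreover have "insert z (s u - {y}) \<subseteq> {..<n} - {u}"
    using strat z z_new by auto
  ultimately show False
    using no_deviation by (simp add: s'_def)
qed

theorem theorem5:
  fixes n :: nat and b c :: real
  assumes "n \<ge> 6" and "b \<ge> 0" and "c > 0"
  shows "\<not> (\<exists>s. strategy_combination n s \<and> path_graph (channel_graph n s) \<and> nash_equilibrium n b c s)"
proof
  assume "\<exists>s. strategy_combination n s \<and> path_graph (channel_graph n s) \<and> nash_equilibrium n b c s"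
  then obtain s where path: "path_graph (channel_graph n s)" and nash: "nash_equilibrium n b c s"
    by blast
  obtain pos where "numbered_path (channel_graph n s) pos"
    using path_graph_numbered_path[OF pair_graph_channel_graph path] by blast
  then interpret P: numbered_path "channel_graph n s" pos .
  have rev: "numbered_path (channel_graph n s) (\<lambda>v. n - 1 - pos v)"
    using P.numbered_path_reverse by simp
  \<comment> \<open>In the forward numbering the bound \<open>pos u + 3 < n\<close> becomes
    \<open>5 < n\<close>. In the reversed one \<open>v\<close> has position \<open>n - 4\<close>,
    directly before \<open>u\<close>, and \<open>n - 4 + 3 < n\<close>.\<close>
  obtain u where u: "u < n" "pos u = 2"
    using P.ex_pos[of 2] assms(1) by auto
  obtain v where v: "v < n" "pos v = 3"
    using P.ex_pos[of 3] assms(1) by auto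
  have "(u, v) \<in> parcs (channel_graph n s)"
    using P.arc_iff[of u v] u v by simp
  then consider "v \<in> s u" | "u \<in> s v"
    by (auto simp: channel_graph_def)
  then show False
  proof cases
    case 1
    show False
      by (rule no_forward_owner[OF P.numbered_path_axioms nash assms(2,3) _ _ 1])
        (use u v assms(1) in auto)
  next
    case 2
    show False
      by (rule no_forward_owner[OF rev nash assms(2,3) _ _ 2]) (use u v assms(1) in auto)
  qed
qed

end
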